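(* Let $r,c\ge 2$ and $m\ge 0$ be integers, and consider the $r\times c$ cylinder graph. Suppose $P$ is a Hamiltonian path that starts at $(0,0)$, ends at a vertex in the last column $c-1$, and uses at most $(c-1)+2m$ horizontal edges. Then $P$ ends at $(x,c-1)$ for some row index $x\in A_{r,c,m}$.
   Context: An $r\times c$ cylinder graph has vertices $(i,j)$, $0\le i\le r-1$, $0\le j\le c-1$ (row $i$, column $j$); $(i,j)$ is adjacent to $(i,j\pm1)$ when that column index lies in $\{0,\dots,c-1\}$ (horizontal edges) and to $(i\pm1 \bmod r,j)$ (vertical edges). A GG path with $2k+1+(c-2)$ horizontal edges ($k\ge 0$) is a Hamiltonian path of one of two forms. Form 1: it starts at $(0,0)$; then uses $r-2k-1$ consecutive vertical edges along $(0,0),(1,0),\dots,(r-2k-1,0)$; then alternates horizontal and vertical edges using $2k+1$ horizontal edges, along $(r-2k-1,0),(r-2k-1,1),(r-2k,1),(r-2k,0),(r-2k+1,0),\dots,(r-1,0),(r-1,1)$, ending at $(r-1,1)$; then traverses the remaining vertices by traversing (the remaining vertices of) a column, taking one horizontal edge to the next column, traversing that column, and so on, ending in the last column and using $c-2$ additional horizontal edges (one between each remaining pair of consecutive columns). Form 2 (mirror image): starts at $(0,0)$; uses $r-2k-1$ vertical edges along $(0,0),(r-1,0),(r-2,0),\dots,(2k+1,0)$; then alternates along $(2k+1,0),(2k+1,1),(2k,1),(2k,0),\dots,(1,0),(1,1)$ using $2k+1$ horizontal edges, ending at $(1,1)$; then traverses the remaining vertices column by column as in Form 1 with $c-2$ additional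 horizontal edges. $A_{r,c,m}$ denotes the set of row indices $x$ such that some GG path in the $r\times c$ cylinder graph using at most $2m+(c-1)$ horizontal edges ends at $(x,c-1)$. *)

theory Defs
  imports Main
begin

type_synonym vertex = "nat \<times> nat"

definition cyl_verts :: "nat \<Rightarrow> nat \<Rightarrow> vertex set" where
  "cyl_verts r c = {0..<r} \<times> {0..<c}"

definition horizontal :: "vertex \<Rightarrow> vertex \<Rightarrow> bool" where
  "horizontal u v \<longleftrightarrow> fst u = fst v \<and> (snd v = snd u + 1 \<or> snd u = snd v + 1)"

definition vertical :: "nat \<Rightarrow> vertex \<Rightarrow> vertex \<Rightarrow> bool" where
  "vertical r u v \<longleftrightarrow> snd u = snd v \<and> (fst v = (fst u + 1) mod r \<or> fst u = (fst v + 1) mod r)"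

definition cyl_adj :: "nat \<Rightarrow> nat \<Rightarrow> vertex \<Rightarrow> vertex \<Rightarrow> bool" where
  "cyl_adj r c u v \<longleftrightarrow>
     u \<in> cyl_verts r c \<and> v \<in> cyl_verts r c \<and> (horizontal u v \<or> vertical r u v)"

definition hamiltonian_path :: "nat \<Rightarrow> nat \<Rightarrow> vertex list \<Rightarrow> bool" where
  "hamiltonian_path r c p \<longleftrightarrow>
     distinct p \<and> set p = cyl_verts r c \<and> successively (cyl_adj r c) p"

definition num_horizontal :: "vertex list \<Rightarrow> nat" where
  "num_horizontal p = card {i. Suc i < length p \<and> horizontal (p ! i) (p ! Suc i)}"

text \<open>The zigzag visits both vertices (columns 0 and 1) of each row in the list \<open>rows\<close>,
  entering the first row in column 0 and changing sides at every step.\<close>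

definition zigzag :: "nat list \<Rightarrow> vertex list" where
  "zigzag rows =
     concat (map (\<lambda>t. if even t then [(rows ! t, 0), (rows ! t, 1)] else [(rows ! t, 1), (rows ! t, 0)])
       [0..<length rows])"

text \<open>Initial parts of the two forms, for \<open>2 * k + 1 \<le> r\<close>. The vertices before the zigzag
  are \<open>(0,0), \<dots>, (r-2k-2,0)\<close>, respectively \<open>(0,0), (r-1,0), \<dots>, (2k+2,0)\<close>.
  In the second form the row \<open>2 * k + 1\<close> is to be read as row 0 when \<open>r = 2 * k + 1\<close>,
  hence the reduction modulo \<open>r\<close>.\<close>

definition gg_start1 :: "nat \<Rightarrow> nat \<Rightarrow> vertex list" where
  "gg_start1 r k =
     map (\<lambda>i. (i, 0)) [0..<r - 2 * k - 1] @ zigzag [r - 2 * k - 1..<r]"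

definition gg_start2 :: "nat \<Rightarrow> nat \<Rightarrow> vertex list" where
  "gg_start2 r k =
     map (\<lambda>i. ((r - i) mod r, 0)) [0..<r - 2 * k - 1] @
     zigzag (map (\<lambda>i. i mod r) (rev [1..<2 * k + 2]))"

text \<open>After its initial part, a GG path traverses the remaining vertices of columns
  \<open>1, \<dots>, c - 1\<close> in this order; \<open>seg j\<close> is the part in column \<open>j\<close>. As the whole list is a path,
  steps inside a segment are vertical and steps between different columns are horizontal.
  The direction of traversal of a column is free.
  If \<open>r = 2 * k + 1\<close>, the initial part exhausts column 1 and \<open>seg 1\<close> is empty.\<close>

definition gg_path :: "nat \<Rightarrow> nat \<Rightarrow> nat \<Rightarrow> vertex list \<Rightarrow> bool" where
  "gg_path r c k p \<longleftrightarrow>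
     2 * k + 1 \<le> r \<and> hamiltonian_path r c p \<and>
     (\<exists>s seg. (s = gg_start1 r k \<or> s = gg_start2 r k) \<and>
        p = s @ concat (map seg [1..<c]) \<and>
        (\<forall>j\<in>{1..<c}. set (seg j) = {0..<r} \<times> {j} - set s))"

definition gg_ends :: "nat \<Rightarrow> nat \<Rightarrow> nat \<Rightarrow> nat set" where
  "gg_ends r c m =
     {x. \<exists>k p. gg_path r c k p \<and> num_horizontal p \<le> 2 * m + (c - 1) \<and> last p = (x, c - 1)}"

end

theory Submission
  imports Defs
begin

text \<open>
  Let \<open>u i\<close> and \<open>d i\<close> count the upward and downward steps of \<open>P\<close> between the rows \<open>i\<close> and
  \<open>i + 1 mod r\<close>. Each of the \<open>c\<close> edges there is used at most once, so \<open>u i + d i \<le> c\<close>, and the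
  net flow \<open>u i - d i\<close> takes only two consecutive values \<open>q\<close>, \<open>q + 1\<close> as \<open>i\<close> varies. Hence
  \<open>K = max d\<close> satisfies \<open>d i \<le> K\<close> and \<open>u i \<le> c - K\<close> for all \<open>i\<close>: the unused vertical edges can
  be oriented so that every gap carries exactly \<open>K\<close> downward and \<open>c - K\<close> upward edges. Modulo \<open>r\<close>
  the total displacement then vanishes, so the final row is congruent to minus the signed number
  of unused vertical edges. There are \<open>h + 1\<close> of those, where \<open>h\<close> is the number of horizontal edges,
  so the final row is congruent to some \<open>y\<close> with \<open>\<bar>y\<bar> \<le> c + 2 * m\<close> and \<open>y\<close> of the parity of \<open>c\<close>.
  Shifts by \<open>2 * r\<close> achieve \<open>\<bar>y\<bar> \<le> r\<close>, and then a GG path with \<open>2 * k + 2 \<le> r\<close> reaches \<open>y\<close>: the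
  first two columns contribute \<open>2 * k + 2\<close> up to sign, or \<open>0\<close>, and every further column \<open>1\<close> up to sign.
\<close>

section \<open>Counting horizontal edges along a list\<close>

lemma num_horizontal_eq_sum:
  "num_horizontal p = (\<Sum>i<length p - 1. of_bool (horizontal (p ! i) (p ! Suc i)))"
proof -
  have "{i. Suc i < length p \<and> horizontal (p ! i) (p ! Suc i)} =
        {..<length p - 1} \<inter> {i. horizontal (p ! i) (p ! Suc i)}"
    by auto
  then show ?thesis
    by (simp add: num_horizontal_def sum.If_cases of_bool_def)
qed

lemma num_horizontal_Nil [simp]: "num_horizontal [] = 0"
  by (simp add: num_horizontal_def)

lemma num_horizontal_single [simp]: "num_horizontal [u] = 0"
  by (simp add: num_horizontal_def)

lemma num_horizontal_Cons [simp]: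
  "num_horizontal (u # v # q) = of_bool (horizontal u v) + num_horizontal (v # q)"
  by (simp add: num_horizontal_eq_sum sum.lessThan_Suc_shift del: sum.lessThan_Suc)

lemma num_horizontal_append:
  assumes "p \<noteq> []" "q \<noteq> []"
  shows "num_horizontal (p @ q) =
    num_horizontal p + of_bool (horizontal (last p) (hd q)) + num_horizontal q"
  using assms
proof (induction p rule: induct_list012)
  case (2 u)
  then show ?case by (cases q) auto
qed auto

lemma num_horizontal_column:
  "(\<And>v. v \<in> set q \<Longrightarrow> snd v = j) \<Longrightarrow> num_horizontal q = 0"
proof (induction q rule: induct_list012)
  case (3 u v q)
  then have "snd u = snd v" by simp
  then have "\<not> horizontal u v" by (simp add: horizontal_def)
  moreover have "num_horizontal (v # q) = 0"
    using 3 by simp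
  ultimately show ?case by simp
qed auto

subsection \<open>Net vertical displacement of a Hamiltonian path\<close>

definition up_step :: "nat \<Rightarrow> vertex \<Rightarrow> vertex \<Rightarrow> bool" where
  "up_step r u v \<longleftrightarrow> snd u = snd v \<and> fst v = (fst u + 1) mod r"

text \<open>For \<open>r = 2\<close> every vertical step goes both up and down; it is counted as up.\<close>

definition down_step :: "nat \<Rightarrow> vertex \<Rightarrow> vertex \<Rightarrow> bool" where
  "down_step r u v \<longleftrightarrow> snd u = snd v \<and> fst u = (fst v + 1) mod r \<and> \<not> up_step r u v"

lemma step_kinds:
  assumes "cyl_adj r c u v"
  shows "of_bool (up_step r u v) + of_bool (down_step r u v) + of_bool (horizontal u v) = (1::int)"
proof -
  have "\<not> (up_step r u v \<and> down_step r u v)" unfolding down_step_def by blast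
  moreover have "horizontal u v \<Longrightarrow> snd u \<noteq> snd v" by (auto simp: horizontal_def)
  then have "horizontal u v \<Longrightarrow> \<not> up_step r u v \<and> \<not> down_step r u v"
    unfolding up_step_def down_step_def by blast
  moreover have "horizontal u v \<or> up_step r u v \<or> down_step r u v"
    using assms unfolding cyl_adj_def vertical_def up_step_def down_step_def by metis
  ultimately show ?thesis by auto
qed

text \<open>An up step from row \<open>a\<close> to \<open>a + 1\<close> turns the indicator of
  \<open>i < row\<close> on exactly at \<open>i = a\<close>, and a down step undoes this. Only a
  step between rows \<open>r - 1\<close> and \<open>0\<close> deviates, and it does so by the same
  amount \<open>\<delta>\<close> for every \<open>i\<close>.\<close>

lemma step_flow:
  assumes "cyl_adj r c u v"
  shows "\<exists>\<delta>::int. \<forall>i<r.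
    of_bool (up_step r u v \<and> fst u = i) - of_bool (down_step r u v \<and> fst v = i) =
    \<delta> + of_bool (i < fst v) - of_bool (i < fst u)"
proof -
  have lt: "fst u < r" "fst v < r"
    using assms by (auto simp: cyl_adj_def cyl_verts_def mem_Times_iff)
  consider (up) "up_step r u v" | (down) "down_step r u v" | (hor) "horizontal u v"
    using assms by (auto simp: cyl_adj_def vertical_def up_step_def down_step_def)
  then show ?thesis
  proof cases
    case up
    then have nd: "\<not> down_step r u v" and v: "fst v = (fst u + 1) mod r"
      by (auto simp: down_step_def up_step_def)
    show ?thesis
    proof (cases "fst u + 1 = r")
      case True
      then show ?thesis using up nd v by (intro exI[of _ 1]) (auto simp: of_bool_def)
    next
      case False
      then have "fst v = fst u + 1" using v lt by simp
      then show ?thesis using up nd by (intro exI[of _ 0]) (auto simp: of_bool_def)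
    qed
  next
    case down
    then have nu: "\<not> up_step r u v" and u: "fst u = (fst v + 1) mod r"
      by (auto simp: down_step_def)
    show ?thesis
    proof (cases "fst v + 1 = r")
      case True
      then show ?thesis using down nu u by (intro exI[of _ "-1"]) (auto simp: of_bool_def)
    next
      case False
      then have "fst u = fst v + 1" using u lt by simp
      then show ?thesis using down nu by (intro exI[of _ 0]) (auto simp: of_bool_def)
    qed
  next
    case hor
    then have "\<not> up_step r u v" "\<not> down_step r u v" "fst u = fst v"
      by (auto simp: horizontal_def up_step_def down_step_def)
    then show ?thesis by (intro exI[of _ 0]) auto
  qed
qed

text \<open>The indicators telescope along the walk, and \<open>q\<close> adds up the constants
  \<open>\<delta>\<close>: it is the net number of crossings of the gap between rows
  \<open>r - 1\<close> and \<open>0\<close>.\<close>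

lemma walk_flow:
  assumes "\<And>t. t < n \<Longrightarrow> cyl_adj r c (P t) (P (Suc t))"
  shows "\<exists>q::int. \<forall>i<r.
    (\<Sum>t<n. of_bool (up_step r (P t) (P (Suc t)) \<and> fst (P t) = i)) -
    (\<Sum>t<n. of_bool (down_step r (P t) (P (Suc t)) \<and> fst (P (Suc t)) = i)) =
    q + of_bool (i < fst (P n)) - of_bool (i < fst (P 0))"
  using assms
proof (induction n)
  case 0
  show ?case by (intro exI[of _ 0]) simp
next
  case (Suc n)
  from Suc.IH Suc.prems obtain q :: int where q: "\<forall>i<r.
    (\<Sum>t<n. of_bool (up_step r (P t) (P (Suc t)) \<and> fst (P t) = i)) -
    (\<Sum>t<n. of_bool (down_step r (P t) (P (Suc t)) \<and> fst (P (Suc t)) = i)) =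
    q + of_bool (i < fst (P n)) - of_bool (i < fst (P 0))"
    by (meson less_Suc_eq)
  obtain \<delta> :: int where \<delta>: "\<forall>i<r.
    of_bool (up_step r (P n) (P (Suc n)) \<and> fst (P n) = i) -
    of_bool (down_step r (P n) (P (Suc n)) \<and> fst (P (Suc n)) = i) =
    \<delta> + of_bool (i < fst (P (Suc n))) - of_bool (i < fst (P n))"
    using step_flow Suc.prems by (meson lessI)
  show ?case
  proof (intro exI[of _ "q + \<delta>"] allI impI)
    fix i assume "i < r"
    with q \<delta> show "(\<Sum>t<Suc n. of_bool (up_step r (P t) (P (Suc t)) \<and> fst (P t) = i)) -
      (\<Sum>t<Suc n. of_bool (down_step r (P t) (P (Suc t)) \<and> fst (P (Suc t)) = i)) =
      q + \<delta> + of_bool (i < fst (P (Suc n))) - of_bool (i < fst (P 0))"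
      unfolding sum.lessThan_Suc by fastforce
  qed
qed

text \<open>A horizontal step flips the parity of the column; a vertical step keeps it.\<close>

lemma walk_parity:
  assumes "\<And>t. t < n \<Longrightarrow> cyl_adj r c (P t) (P (Suc t))"
  shows "even ((\<Sum>t<n. of_bool (horizontal (P t) (P (Suc t)))) + snd (P n) + snd (P 0))"
  using assms
proof (induction n)
  case (Suc n)
  have "cyl_adj r c (P n) (P (Suc n))" using Suc.prems by simp
  then have "even (of_bool (horizontal (P n) (P (Suc n))) + snd (P n) + snd (P (Suc n)))"
    by (auto simp: cyl_adj_def horizontal_def vertical_def)
  moreover have "even ((\<Sum>t<n. of_bool (horizontal (P t) (P (Suc t)))) + snd (P n) + snd (P 0))"
    using Suc by simp
  ultimately show ?case by auto
qed simp

text \<open>Sending a step across the gap above row \<open>i\<close> to its column is injective. Two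
  steps in the same direction and column would both start or both end at \<open>(i, j)\<close>; two
  in opposite directions would each have to follow the other directly.\<close>

lemma gap_usage_le:
  assumes "distinct P" and adj: "\<And>t. Suc t < length P \<Longrightarrow> cyl_adj r c (P ! t) (P ! Suc t)"
  shows "(\<Sum>t<length P - 1. of_bool (up_step r (P ! t) (P ! Suc t) \<and> fst (P ! t) = i)) +
    (\<Sum>t<length P - 1. of_bool (down_step r (P ! t) (P ! Suc t) \<and> fst (P ! Suc t) = i)) \<le> int c"
proof -
  let ?N = "length P - 1"
  define U where "U = {t. t < ?N \<and> up_step r (P ! t) (P ! Suc t) \<and> fst (P ! t) = i}"
  define D where "D = {t. t < ?N \<and> down_step r (P ! t) (P ! Suc t) \<and> fst (P ! Suc t) = i}"
  have inj: "s = t" if "P ! s = P ! t" "s < length P" "t < length P" for s t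
    using that assms(1) nth_eq_iff_index_eq by blast
  have UD: "U \<inter> D = {}" "finite U" "finite D"
    by (auto simp: U_def D_def down_step_def)
  have uu: "s = t" if "s \<in> U" "t \<in> U" "snd (P ! s) = snd (P ! t)" for s t
    using that by (intro inj) (auto simp: U_def prod_eq_iff)
  have dd: "s = t" if "s \<in> D" "t \<in> D" "snd (P ! s) = snd (P ! t)" for s t
  proof -
    have "Suc s = Suc t"
      using that by (intro inj) (auto simp: D_def prod_eq_iff down_step_def)
    then show ?thesis by simp
  qed
  have ud: False if "s \<in> U" "t \<in> D" "snd (P ! s) = snd (P ! t)" for s t
  proof -
    have "s = Suc t"
      using that by (intro inj) (auto simp: U_def D_def prod_eq_iff down_step_def)
    moreover have "Suc s = t"
      using that by (intro inj) (auto simp: U_def D_def prod_eq_iff down_step_def up_step_def)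
    ultimately show False by simp
  qed
  have "inj_on (\<lambda>t. snd (P ! t)) (U \<union> D)"
    unfolding inj_on_def using uu dd ud by (metis UnE)
  moreover have "(\<lambda>t. snd (P ! t)) ` (U \<union> D) \<subseteq> {..<c}"
  proof -
    have "snd (P ! t) < c" if "t < ?N" for t
      using adj[of t] that by (simp add: cyl_adj_def cyl_verts_def mem_Times_iff)
    then show ?thesis by (auto simp: U_def D_def)
  qed
  ultimately have "card (U \<union> D) \<le> c"
    by (metis card_inj_on_le card_lessThan finite_lessThan)
  then have "card U + card D \<le> c"
    using UD by (simp add: card_Un_disjoint)
  moreover have
    "(\<Sum>t<?N. of_bool (up_step r (P ! t) (P ! Suc t) \<and> fst (P ! t) = i)) = int (card U)"
    "(\<Sum>t<?N. of_bool (down_step r (P ! t) (P ! Suc t) \<and> fst (P ! Suc t) = i)) = int (card D)"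
    by (simp_all add: sum.If_cases of_bool_def U_def D_def lessThan_def Int_def)
  ultimately show ?thesis by linarith
qed

lemma uniform_split:
  fixes u d :: "nat \<Rightarrow> int"
  assumes "r > 0" and flow: "\<And>i. i < r \<Longrightarrow> u i - d i \<in> {q, q + 1}"
    and cap: "\<And>i. i < r \<Longrightarrow> u i + d i \<le> c"
  shows "\<exists>K. sum d {..<r} \<le> int r * K \<and> sum u {..<r} \<le> int r * (c - K)"
proof -
  define K where "K = Max (d ` {..<r})"
  have "K \<in> d ` {..<r}"
    unfolding K_def using assms(1) by (intro Max_in) auto
  then obtain j where j: "j < r" "d j = K" by auto
  have "d i \<le> K" if "i < r" for i
    unfolding K_def using that by (intro Max_ge) auto
  then have "sum d {..<r} \<le> int r * K"
    using sum_bounded_above[of "{..<r}" d K] by simp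
  \<comment> \<open>At the maximizing gap \<open>j\<close>,
    \<open>q \<le> u j - K \<le> c - 2 * K\<close>. If \<open>u i > c - K\<close>, then
    \<open>cap\<close> gives \<open>d i < K\<close>, so
    \<open>u i - d i \<ge> c - 2 * K + 2 \<ge> q + 2\<close>, against \<open>flow\<close>.\<close>
  moreover have "u i \<le> c - K" if "i < r" for i
    using flow[OF that] cap[OF that] flow[OF j(1)] cap[OF j(1)] j(2) by auto
  then have "sum u {..<r} \<le> int r * (c - K)"
    using sum_bounded_above[of "{..<r}" u "c - K"] by simp
  ultimately show ?thesis by blast
qed

text \<open>The \<open>r\<close> gaps offer \<open>c\<close> places each for vertical steps. Of the
  \<open>r * c - 1\<close> steps of \<open>P\<close>, the vertical ones leave
  \<open>num_horizontal P + 1\<close> places empty, which is the bound on \<open>y\<close>.\<close>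

lemma hamiltonian_path_end:
  assumes r: "r > 0" and c: "c > 0" and P: "hamiltonian_path r c P" and hd: "hd P = (0, 0)"
  shows "\<exists>y::int. \<bar>y\<bar> \<le> int (num_horizontal P) + 1 \<and> even (y + int (snd (last P)) + 1) \<and>
    y mod int r = int (fst (last P))"
proof -
  define N where "N = length P - 1"
  have dist: "distinct P" and set: "set P = cyl_verts r c"
    and succ: "successively (cyl_adj r c) P"
    using P by (auto simp: hamiltonian_path_def)
  have len: "length P = r * c"
    using distinct_card[OF dist] set by (simp add: cyl_verts_def)
  then have pos: "length P > 0" and ne: "P \<noteq> []" using r c by auto
  have adj: "cyl_adj r c (P ! t) (P ! Suc t)" if "Suc t < length P" for t
    using succ that by (simp add: successively_conv_nth)
  have P0: "P ! 0 = (0, 0)" using hd ne by (simp add: hd_conv_nth)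
  have PN: "P ! N = last P" using ne by (simp add: last_conv_nth N_def)
  define x where "x = fst (last P)"
  have x: "x < r" using set ne last_in_set[OF ne] by (simp add: x_def cyl_verts_def mem_Times_iff)
  define u d :: "nat \<Rightarrow> int" where
    "u i = (\<Sum>t<N. of_bool (up_step r (P ! t) (P ! Suc t) \<and> fst (P ! t) = i))" and
    "d i = (\<Sum>t<N. of_bool (down_step r (P ! t) (P ! Suc t) \<and> fst (P ! Suc t) = i))" for i
  have adjN: "cyl_adj r c (P ! t) (P ! Suc t)" if "t < N" for t
    using adj[of t] that by (simp add: N_def)
  \<comment> \<open>The start row is \<open>0\<close>, so its indicator vanishes.\<close>
  obtain q where q: "u i - d i = q + of_bool (i < x)" if "i < r" for i
    using walk_flow[of N r c "(!) P"] adjN P0 PN by (auto simp: u_def d_def x_def)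
  have "\<exists>K. sum d {..<r} \<le> int r * K \<and> sum u {..<r} \<le> int r * (int c - K)"
  proof (rule uniform_split[OF r])
    show "u i - d i \<in> {q, q + 1}" if "i < r" for i
      using q[OF that] by auto
    show "u i + d i \<le> int c" for i
      using gap_usage_le[OF dist adj, of i] by (simp add: u_def d_def N_def)
  qed
  then obtain K where K: "sum d {..<r} \<le> int r * K" "sum u {..<r} \<le> int r * (int c - K)"
    by blast
  have "sum u {..<r} - sum d {..<r} = (\<Sum>i<r. q + of_bool (i < x))"
    using q by (simp flip: sum_subtractf)
  also have "\<dots> = int r * q + (\<Sum>i<r. of_bool (i < x))"
    by (simp add: sum.distrib)
  also have "(\<Sum>i<r. of_bool (i < x)) = int x"
  proof -
    have "{..<r} \<inter> {i. i < x} = {..<x}" using x by auto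
    then show ?thesis by (simp add: sum.If_cases of_bool_def)
  qed
  finally have ud: "sum u {..<r} - sum d {..<r} = int r * q + int x" .
  have su: "sum u {..<r} = (\<Sum>t<N. of_bool (up_step r (P ! t) (P ! Suc t)))"
    unfolding u_def
  proof (subst sum.swap, intro sum.cong refl)
    fix t assume "t \<in> {..<N}"
    then have "fst (P ! t) < r"
      using adjN[of t] by (auto simp: cyl_adj_def cyl_verts_def mem_Times_iff)
    then show "(\<Sum>i<r. of_bool (up_step r (P ! t) (P ! Suc t) \<and> fst (P ! t) = i)) =
      (of_bool (up_step r (P ! t) (P ! Suc t)) :: int)"
      by (cases "up_step r (P ! t) (P ! Suc t)") (auto simp: of_bool_def)
  qed
  have sd: "sum d {..<r} = (\<Sum>t<N. of_bool (down_step r (P ! t) (P ! Suc t)))"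
    unfolding d_def
  proof (subst sum.swap, intro sum.cong refl)
    fix t assume "t \<in> {..<N}"
    then have "fst (P ! Suc t) < r"
      using adjN[of t] by (auto simp: cyl_adj_def cyl_verts_def mem_Times_iff)
    then show "(\<Sum>i<r. of_bool (down_step r (P ! t) (P ! Suc t) \<and> fst (P ! Suc t) = i)) =
      (of_bool (down_step r (P ! t) (P ! Suc t)) :: int)"
      by (cases "down_step r (P ! t) (P ! Suc t)") (auto simp: of_bool_def)
  qed
  have h: "num_horizontal P = (\<Sum>t<N. of_bool (horizontal (P ! t) (P ! Suc t)))"
    by (simp add: num_horizontal_eq_sum N_def)
  have "sum u {..<r} + sum d {..<r} + int (num_horizontal P) = (\<Sum>t<N. 1)"
    unfolding su sd h of_nat_sum sum.distrib[symmetric]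
  proof (intro sum.cong refl)
    fix t assume "t \<in> {..<N}"
    then show "of_bool (up_step r (P ! t) (P ! Suc t)) + of_bool (down_step r (P ! t) (P ! Suc t)) +
        int (of_bool (horizontal (P ! t) (P ! Suc t))) = 1"
      using step_kinds adjN[of t] by simp
  qed
  then have total: "sum u {..<r} + sum d {..<r} + int (num_horizontal P) + 1 = int r * int c"
    using len pos by (simp add: N_def flip: of_nat_mult)
  \<comment> \<open>Empty downward places minus empty upward places. Both brackets are nonnegative
    by \<open>K\<close>, and by \<open>total\<close> they add up to the number of all empty places;
    this yields both the bound and the parity.\<close>
  define y where "y = (int r * K - sum d {..<r}) - (int r * (int c - K) - sum u {..<r})"
  have abs: "\<bar>y\<bar> \<le> int (num_horizontal P) + 1"
    using K total by (simp add: y_def algebra_simps)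
  have "y + (int (num_horizontal P) + 1) = 2 * (int r * K - sum d {..<r})"
    using total by (simp add: y_def algebra_simps)
  then have "even (y + (int (num_horizontal P) + 1))" by simp
  moreover have "even (num_horizontal P + snd (last P))"
    using walk_parity[of N r c "(!) P"] adjN P0 PN by (simp add: h)
  then have "even (int (num_horizontal P) + int (snd (last P)))"
    by (simp flip: of_nat_add)
  ultimately have par: "even (y + int (snd (last P)) + 1)" by presburger
  \<comment> \<open>Apart from \<open>sum u {..<r} - sum d {..<r}\<close>, which is \<open>x\<close>
    modulo \<open>r\<close>, every term of \<open>y\<close> is a multiple of
    \<open>r\<close>.\<close>
  have "y = int x + int r * (q + 2 * K - int c)"
    using ud by (simp add: y_def algebra_simps)
  then have "y mod int r = int x" using x by simp
  with abs par show ?thesis unfolding x_def by blast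
qed

subsection \<open>GG paths with a prescribed displacement\<close>

lemma zigzag_Nil [simp]: "zigzag [] = []"
  by (simp add: zigzag_def)

lemma zigzag_snoc:
  "zigzag (rows @ [a]) =
    zigzag rows @ (if even (length rows) then [(a, 0), (a, 1)] else [(a, 1), (a, 0)])"
proof -
  have "map (\<lambda>t. if even t then [((rows @ [a]) ! t, 0), ((rows @ [a]) ! t, 1)]
           else [((rows @ [a]) ! t, 1), ((rows @ [a]) ! t, 0)]) [0..<length rows] =
        map (\<lambda>t. if even t then [(rows ! t, 0::nat), (rows ! t, 1)]
           else [(rows ! t, 1), (rows ! t, 0)]) [0..<length rows]"
    by (intro map_cong) (auto simp: nth_append)
  then show ?thesis by (simp add: zigzag_def del: map_eq_conv)
qed

lemma set_zigzag: "set (zigzag rows) = set rows \<times> {0, 1}"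
  by (induction rows rule: rev_induct) (auto simp: zigzag_snoc)

lemma distinct_zigzag: "distinct rows \<Longrightarrow> distinct (zigzag rows)"
  by (induction rows rule: rev_induct) (auto simp: zigzag_snoc set_zigzag)

lemma map_zigzag: "map (map_prod f id) (zigzag rows) = zigzag (map f rows)"
  by (induction rows rule: rev_induct) (auto simp: zigzag_snoc)

lemma zigzag_eq_Nil [simp]: "zigzag rows = [] \<longleftrightarrow> rows = []"
  by (cases rows rule: rev_cases) (auto simp: zigzag_snoc)

text \<open>Each further row adds one vertical step in the current column and one horizontal step.
  The induction has to follow both parities; GG paths use \<open>n = 2 * k\<close>, which ends in
  column \<open>1\<close>.\<close>

lemma zigzag_upt:
  assumes "a + Suc n \<le> r" "c \<ge> 2"
  shows "successively (cyl_adj r c) (zigzag [a..<a + Suc n]) \<and>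
    num_horizontal (zigzag [a..<a + Suc n]) = Suc n \<and> hd (zigzag [a..<a + Suc n]) = (a, 0) \<and>
    last (zigzag [a..<a + Suc n]) = (a + n, if even n then 1 else 0)"
  using assms(1)
proof (induction n)
  case 0
  then show ?case
    using assms(2) by (auto simp: zigzag_def cyl_adj_def cyl_verts_def horizontal_def)
next
  case (Suc n)
  let ?z = "zigzag [a..<a + Suc n]"
  let ?e = "if even (Suc n) then [(a + Suc n, 0), (a + Suc n, 1)] else [(a + Suc n, 1), (a + Suc n, 0)]"
  have z: "zigzag [a..<a + Suc (Suc n)] = ?z @ ?e"
    using zigzag_snoc[of "[a..<a + Suc n]" "a + Suc n"] by simp
  have ne: "?z \<noteq> []" by simp
  have IH: "successively (cyl_adj r c) ?z" "num_horizontal ?z = Suc n" "hd ?z = (a, 0)"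
    "last ?z = (a + n, if even n then 1 else 0)"
    using Suc by auto
  have "vertical r (a + n, j) (a + Suc n, j)" for j
    using Suc.prems by (simp add: vertical_def)
  moreover have "\<not> horizontal (a + n, j) (a + Suc n, j')" for j j'
    by (simp add: horizontal_def)
  moreover have "horizontal (a + Suc n, 0) (a + Suc n, 1)" "horizontal (a + Suc n, 1) (a + Suc n, 0)"
    by (auto simp: horizontal_def)
  ultimately show ?case
    unfolding z using ne IH Suc.prems assms(2)
    by (auto simp: successively_append_iff num_horizontal_append cyl_adj_def cyl_verts_def
        simp del: upt_Suc)
qed

text \<open>A list of at most \<open>r * c\<close> entries that covers \<open>r * c\<close> vertices
  cannot repeat one, so distinctness comes for free.\<close>

lemma hamiltonian_pathI:
  assumes "set p = cyl_verts r c" "length p \<le> r * c" "successively (cyl_adj r c) p"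
  shows "hamiltonian_path r c p"
proof -
  have "card (set p) = r * c" using assms(1) by (simp add: cyl_verts_def)
  then have "distinct p"
    using assms(2) card_length[of p] by (intro card_distinct) simp
  with assms show ?thesis by (simp add: hamiltonian_path_def)
qed

lemma successively_column:
  assumes "a + n \<le> r" "j < c"
  shows "successively (cyl_adj r c) (map (\<lambda>i. (i, j)) [a..<a + n])"
  using assms
  by (auto simp: successively_conv_nth cyl_adj_def cyl_verts_def vertical_def)

text \<open>The bound on \<open>k\<close> leaves at least one vertex before the zigzag, so that the
  join of the two parts is a vertical step, and at least one unvisited vertex in column
  \<open>1\<close>.\<close>

lemma gg_start1_props:
  assumes "2 * k + 2 \<le> r" "c \<ge> 2"
  shows "successively (cyl_adj r c) (gg_start1 r k)"
    and "num_horizontal (gg_start1 r k) = 2 * k + 1"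
    and "last (gg_start1 r k) = (r - 1, 1)"
    and "set (gg_start1 r k) = {0..<r} \<times> {0} \<union> {r - 2 * k - 1..<r} \<times> {1}"
    and "length (gg_start1 r k) = r + 2 * k + 1"
proof -
  define a where "a = r - 2 * k - 1"
  have a: "a > 0" "r = a + Suc (2 * k)" using assms by (auto simp: a_def)
  let ?c = "map (\<lambda>i. (i, 0::nat)) [0..<a]"
  let ?z = "zigzag [a..<a + Suc (2 * k)]"
  have g: "gg_start1 r k = ?c @ ?z"
    using a by (simp add: gg_start1_def)
  have ne: "?c \<noteq> []" "?z \<noteq> []" using a by auto
  have lc: "last ?c = (a - 1, 0)" using a by (simp add: last_map)
  have z: "successively (cyl_adj r c) ?z" "num_horizontal ?z = 2 * k + 1" "hd ?z = (a, 0)"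
    "last ?z = (a + 2 * k, 1)"
    using zigzag_upt[of a "2 * k" r c] a assms(2) by (auto simp del: upt_Suc)
  have c: "successively (cyl_adj r c) ?c"
    using successively_column[of 0 a r 0 c] a assms(2) by simp
  have nc: "num_horizontal ?c = 0" by (rule num_horizontal_column[of _ 0]) auto
  have adj: "cyl_adj r c (a - 1, 0) (a, 0)"
    using a assms(2) by (auto simp: cyl_adj_def cyl_verts_def vertical_def)
  show "successively (cyl_adj r c) (gg_start1 r k)"
    unfolding g successively_append_iff lc z(3) using c z(1) adj by blast
  show "num_horizontal (gg_start1 r k) = 2 * k + 1"
    unfolding g num_horizontal_append[OF ne] lc z nc using a by (simp add: horizontal_def)
  show "last (gg_start1 r k) = (r - 1, 1)"
    unfolding g using ne z a by simp
  show s: "set (gg_start1 r k) = {0..<r} \<times> {0} \<union> {r - 2 * k - 1..<r} \<times> {1}"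
    unfolding g using a by (auto simp: set_zigzag simp del: upt_Suc)
  have "distinct (gg_start1 r k)"
    unfolding g by (auto simp: distinct_zigzag set_zigzag distinct_map inj_on_def simp del: upt_Suc)
  then have "length (gg_start1 r k) = card ({0..<r} \<times> {0::nat} \<union> {r - 2 * k - 1..<r} \<times> {1})"
    using distinct_card s by metis
  also have "\<dots> = r + 2 * k + 1"
    using assms by (subst card_Un_disjoint) auto
  finally show "length (gg_start1 r k) = r + 2 * k + 1" .
qed

text \<open>The list \<open>q\<close> through the rest of column \<open>1\<close> stays a parameter,
  since it is used both ascending from row \<open>0\<close> and, for \<open>k = 0\<close>,
  descending from row \<open>r - 2\<close>. Only the first form is built; the second arises by
  reflection.\<close>

lemma gg_path_two_columns:
  assumes k: "2 * k + 2 \<le> r"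
    and q: "successively (cyl_adj r 2) q" "length q = r - 2 * k - 1"
      "set q = {0..<r - 2 * k - 1} \<times> {1}" "vertical r (r - 1, 1) (hd q)"
  shows "gg_path r 2 k (gg_start1 r k @ q)"
    and "num_horizontal (gg_start1 r k @ q) = 2 * k + 1"
    and "last (gg_start1 r k @ q) = last q"
proof -
  note s = gg_start1_props[OF k order_refl]
  have ne: "gg_start1 r k \<noteq> []" "q \<noteq> []" using s(5) q(2) k by auto
  have "hd q \<in> {0..<r - 2 * k - 1} \<times> {1}"
    using hd_in_set[OF ne(2)] q(3) by simp
  then have adj: "cyl_adj r 2 (r - 1, 1) (hd q)"
    using q(4) by (auto simp: cyl_adj_def cyl_verts_def)
  have "hamiltonian_path r 2 (gg_start1 r k @ q)"
  proof (rule hamiltonian_pathI)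
    have "{0..<r} = {0..<r - 2 * k - 1} \<union> {r - 2 * k - 1..<r}" by auto
    moreover have "{0..<2} = {0, 1::nat}" by auto
    ultimately show "set (gg_start1 r k @ q) = cyl_verts r 2"
      unfolding set_append s(4) q(3) cyl_verts_def by blast
    show "length (gg_start1 r k @ q) \<le> r * 2"
      using s(5) q(2) k by simp
    show "successively (cyl_adj r 2) (gg_start1 r k @ q)"
      unfolding successively_append_iff s(3) using s(1) q(1) adj by blast
  qed
  moreover have "gg_start1 r k @ q = gg_start1 r k @ concat (map (\<lambda>_. q) [1..<2])"
    by (simp add: numeral_2_eq_2)
  moreover have "set q = {0..<r} \<times> {1} - set (gg_start1 r k)"
    unfolding s(4) q(3) by auto
  then have "\<forall>j\<in>{1..<2}. set q = {0..<r} \<times> {j} - set (gg_start1 r k)"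
    using le_less_Suc_eq numeral_2_eq_2 by fastforce
  moreover have "2 * k + 1 \<le> r" using k by simp
  ultimately show "gg_path r 2 k (gg_start1 r k @ q)"
    unfolding gg_path_def by (intro conjI exI[of _ "gg_start1 r k"] exI[of _ "\<lambda>_. q"] disjI1 refl)
  have snd1: "snd v = 1" if "v \<in> set q" for v
    using that unfolding q(3) by (simp add: mem_Times_iff)
  have "num_horizontal q = 0"
    by (rule num_horizontal_column[OF snd1])
  moreover have "\<not> horizontal (r - 1, 1) (hd q)"
    using snd1[OF hd_in_set[OF ne(2)]] by (simp add: horizontal_def)
  ultimately show "num_horizontal (gg_start1 r k @ q) = 2 * k + 1"
    by (simp add: num_horizontal_append[OF ne] s)
  show "last (gg_start1 r k @ q) = last q" using ne by simp
qed

section \<open>Displacements reached, column by column\<close>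

text \<open>The displacement is an integer, though only its residue matters, so that further columns
  and reflection act on it by subtraction and negation.\<close>

definition gg_reaches :: "nat \<Rightarrow> nat \<Rightarrow> nat \<Rightarrow> int \<Rightarrow> bool" where
  "gg_reaches r c k y \<longleftrightarrow>
    (\<exists>p. gg_path r c k p \<and> num_horizontal p = 2 * k + 1 + (c - 2) \<and>
      last p = (nat (y mod int r), c - 1))"

text \<open>From \<open>(r - 1, 1)\<close> the path wraps to row \<open>0\<close> and ascends to row
  \<open>r - 2 * k - 2\<close>, the last one free in column \<open>1\<close>.\<close>

lemma gg_reaches_base:
  assumes k: "2 * k + 2 \<le> r"
  shows "gg_reaches r 2 k (- (2 * int k + 2))"
proof -
  let ?q = "map (\<lambda>i. (i, 1::nat)) [0..<r - 2 * k - 1]"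
  have q: "successively (cyl_adj r 2) ?q"
    using successively_column[of 0 "r - 2 * k - 1" r 1 2] by simp
  have hd: "hd ?q = (0, 1)" using k by (simp add: hd_map)
  have last: "last ?q = (r - 2 * k - 2, 1)"
    using k by (simp add: last_map)
  have "- (2 * int k + 2) = int (r - 2 * k - 2) + int r * (- 1)"
    using k by simp
  then have "- (2 * int k + 2) mod int r = int (r - 2 * k - 2) mod int r"
    by (simp only: mod_mult_self2)
  also have "\<dots> = int (r - 2 * k - 2)"
    using k by (intro mod_pos_pos_trivial) auto
  finally have "nat (- (2 * int k + 2) mod int r) = r - 2 * k - 2" by (simp only: nat_int)
  moreover have "vertical r (r - 1, 1) (hd ?q)"
    using k hd by (auto simp: vertical_def)
  ultimately show ?thesis
    using gg_path_two_columns[OF k q] last unfolding gg_reaches_def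
    by (intro exI[of _ "gg_start1 r k @ ?q"]) auto
qed

text \<open>For \<open>c = 2\<close> the displacement \<open>0\<close> is not covered by \<open>gg_reaches_base\<close> and its reflection;
  it needs column \<open>1\<close> to be traversed in descending order.\<close>

lemma gg_reaches_zero:
  assumes r: "2 \<le> r"
  shows "gg_reaches r 2 0 0"
proof -
  let ?q = "rev (map (\<lambda>i. (i, 1::nat)) [0..<r - 1])"
  have up: "successively (cyl_adj r 2) (map (\<lambda>i. (i, 1)) [0..<r - 1])"
    using successively_column[of 0 "r - 1" r 1 2] by simp
  have q: "successively (cyl_adj r 2) ?q"
    unfolding successively_rev
    by (rule successively_mono[OF up]) (auto simp: cyl_adj_def horizontal_def vertical_def)
  have hd: "hd ?q = (r - 2, 1)" using r by (simp add: hd_rev last_map)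
  have last: "last ?q = (0, 1)"
    using r by (simp add: last_rev hd_map)
  have "vertical r (r - 1, 1) (hd ?q)"
    using r hd by (auto simp: vertical_def)
  then show ?thesis
    using gg_path_two_columns[of 0 r, OF _ q] last r unfolding gg_reaches_def
    by (intro exI[of _ "gg_start1 r 0 @ ?q"]) auto
qed

text \<open>The new column is entered in the row where the old path ends and traversed upward; its
  \<open>r - 1\<close> up steps amount to \<open>-1\<close> modulo \<open>r\<close>.\<close>

lemma gg_reaches_Suc:
  assumes c: "c \<ge> 2" and reach: "gg_reaches r c k y"
  shows "gg_reaches r (Suc c) k (y - 1)"
proof -
  from reach obtain p where gg: "gg_path r c k p"
    and nh: "num_horizontal p = 2 * k + 1 + (c - 2)"
    and lastp: "last p = (nat (y mod int r), c - 1)"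
    by (auto simp: gg_reaches_def)
  from gg obtain s seg where k: "2 * k + 1 \<le> r" and ham: "hamiltonian_path r c p"
    and s: "s = gg_start1 r k \<or> s = gg_start2 r k" and p: "p = s @ concat (map seg [1..<c])"
    and seg: "\<And>j. j \<in> {1..<c} \<Longrightarrow> set (seg j) = {0..<r} \<times> {j} - set s"
    by (auto simp: gg_path_def)
  have setp: "set p = cyl_verts r c" and succ: "successively (cyl_adj r c) p"
    and dist: "distinct p"
    using ham by (auto simp: hamiltonian_path_def)
  have r: "r > 0" using k by simp
  have lenp: "length p = r * c"
    using distinct_card[OF dist] setp by (simp add: cyl_verts_def)
  then have ne: "p \<noteq> []" using r c by auto
  define a where "a = nat (y mod int r)"
  have a: "a < r" "int a = y mod int r" using r by (auto simp: a_def nat_less_iff)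
  define q where "q = map (\<lambda>i. ((a + i) mod r, c)) [0..<r]"
  have lenq: "length q = r" by (simp add: q_def)
  then have neq: "q \<noteq> []" using r by auto
  have hdq: "hd q = (a, c)" using r a by (simp add: q_def hd_map)
  have lastq: "last q = ((a + (r - 1)) mod r, c)" using r by (simp add: q_def last_map)
  have setq: "set q = {0..<r} \<times> {c}"
  proof -
    have "\<exists>i\<in>{0..<r}. b = (a + i) mod r" if "b < r" for b
    proof (cases "a \<le> b")
      case True
      then show ?thesis using that by (intro bexI[of _ "b - a"]) auto
    next
      case False
      then show ?thesis using that a(1) by (intro bexI[of _ "b + r - a"]) auto
    qed
    then show ?thesis using r unfolding q_def by (auto simp: image_iff)
  qed
  have succq: "successively (cyl_adj r (Suc c)) q"
    using r by (auto simp: q_def successively_conv_nth cyl_adj_def cyl_verts_def vertical_def mod_Suc_eq)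
  have succp: "successively (cyl_adj r (Suc c)) p"
    using succ by (rule successively_mono) (auto simp: cyl_adj_def cyl_verts_def)
  have hor: "horizontal (last p) (hd q)"
    using c by (simp add: lastp hdq horizontal_def a_def)
  then have adj: "cyl_adj r (Suc c) (last p) (hd q)"
    using a(1) c lastp hdq by (auto simp: cyl_adj_def cyl_verts_def a_def)
  have "hamiltonian_path r (Suc c) (p @ q)"
  proof (rule hamiltonian_pathI)
    show "set (p @ q) = cyl_verts r (Suc c)"
      using setp setq by (auto simp: cyl_verts_def)
    show "length (p @ q) \<le> r * Suc c" by (simp add: lenp lenq)
    show "successively (cyl_adj r (Suc c)) (p @ q)"
      using succp succq adj by (simp add: successively_append_iff)
  qed
  moreover have "p @ q = s @ concat (map (seg(c := q)) [1..<Suc c])"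
    using c p by simp
  \<comment> \<open>The initial part misses the new column, so the segment there must be the whole
    column, as \<open>q\<close> is.\<close>
  moreover have "set s \<subseteq> cyl_verts r c" using setp p by auto
  then have "{0..<r} \<times> {c} \<inter> set s = {}" by (auto simp: cyl_verts_def)
  then have "\<forall>j\<in>{1..<Suc c}. set ((seg(c := q)) j) = {0..<r} \<times> {j} - set s"
    using seg setq by (auto simp: less_Suc_eq)
  ultimately have "gg_path r (Suc c) k (p @ q)"
    unfolding gg_path_def using k s by blast
  moreover have "num_horizontal q = 0"
    by (rule num_horizontal_column[of _ c]) (auto simp: q_def)
  then have "num_horizontal (p @ q) = 2 * k + 1 + (Suc c - 2)"
    using nh hor c by (simp add: num_horizontal_append[OF ne neq])
  moreover have "int ((a + (r - 1)) mod r) = (y - 1) mod int r"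
  proof -
    have "int ((a + (r - 1)) mod r) = (y mod int r + int r - 1) mod int r"
      using r a(2) by (simp add: zmod_int of_nat_diff algebra_simps)
    also have "\<dots> = (y mod int r - 1 + int r) mod int r" by (simp add: algebra_simps)
    also have "\<dots> = (y - 1) mod int r" by (simp add: mod_diff_left_eq)
    finally show ?thesis .
  qed
  then have "last (p @ q) = (nat ((y - 1) mod int r), Suc c - 1)"
    using neq lastq by (metis diff_Suc_1 last_appendR nat_int)
  ultimately show ?thesis unfolding gg_reaches_def by blast
qed

section \<open>Reflection of the rows\<close>

text \<open>Negation of the row modulo \<open>r\<close>, an automorphism of the cylinder fixing
  \<open>(0, 0)\<close>; the outer \<open>mod\<close> keeps row \<open>0\<close> in place.\<close>

definition reflect :: "nat \<Rightarrow> vertex \<Rightarrow> vertex" where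
  "reflect r = map_prod (\<lambda>i. (r - i) mod r) id"

lemma reflect_invol: "v \<in> cyl_verts r c \<Longrightarrow> reflect r (reflect r v) = v"
  by (cases "fst v = 0") (auto simp: reflect_def cyl_verts_def)

lemma reflect_in: "v \<in> cyl_verts r c \<Longrightarrow> reflect r v \<in> cyl_verts r c"
  by (auto simp: reflect_def cyl_verts_def)

lemma horizontal_reflect: "horizontal u v \<Longrightarrow> horizontal (reflect r u) (reflect r v)"
  by (auto simp: reflect_def horizontal_def)

lemma cyl_adj_reflect:
  assumes "cyl_adj r c u v"
  shows "cyl_adj r c (reflect r u) (reflect r v)"
proof -
  \<comment> \<open>This is \<open>- i = - (i + 1) + 1\<close> modulo \<open>r\<close>: up steps
    become down steps.\<close>
  have neg: "(r - i) mod r = ((r - (i + 1) mod r) mod r + 1) mod r" if "i < r" for i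
    using that by (cases "i + 1 = r") (auto simp: mod_Suc_eq Suc_diff_Suc)
  have "vertical r (reflect r u) (reflect r v)" if "vertical r u v"
    using that assms neg[of "fst u"] neg[of "fst v"]
    by (auto simp: vertical_def reflect_def cyl_adj_def cyl_verts_def)
  with assms show ?thesis
    unfolding cyl_adj_def using horizontal_reflect reflect_in by blast
qed

lemma reflect_gg_start1:
  assumes "2 * k + 1 \<le> r"
  shows "map (reflect r) (gg_start1 r k) = gg_start2 r k"
proof -
  have "map (\<lambda>i. (r - i) mod r) [r - 2 * k - 1..<r] = map (\<lambda>i. i mod r) (rev [1..<2 * k + 2])"
    using assms by (intro nth_equalityI) (auto simp: rev_nth Suc_diff_le simp del: upt_Suc)
  then show ?thesis
    by (simp add: gg_start1_def gg_start2_def reflect_def map_zigzag)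
qed

text \<open>Reflecting the whole path swaps the two forms, keeps columns and horizontal edges, and
  negates the end row.\<close>

lemma gg_reaches_uminus:
  assumes c: "c \<ge> 1" and reach: "gg_reaches r c k y"
  shows "gg_reaches r c k (- y)"
proof -
  from reach obtain p where gg: "gg_path r c k p"
    and nh: "num_horizontal p = 2 * k + 1 + (c - 2)"
    and lastp: "last p = (nat (y mod int r), c - 1)"
    by (auto simp: gg_reaches_def)
  from gg obtain s seg where k: "2 * k + 1 \<le> r" and ham: "hamiltonian_path r c p"
    and s: "s = gg_start1 r k \<or> s = gg_start2 r k" and p: "p = s @ concat (map seg [1..<c])"
    and seg: "\<And>j. j \<in> {1..<c} \<Longrightarrow> set (seg j) = {0..<r} \<times> {j} - set s"
    by (auto simp: gg_path_def)
  let ?f = "reflect r"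
  have setp: "set p = cyl_verts r c" and succ: "successively (cyl_adj r c) p"
    and dist: "distinct p"
    using ham by (auto simp: hamiltonian_path_def)
  have r: "r > 0" using k by simp
  have lenp: "length p = r * c"
    using distinct_card[OF dist] setp by (simp add: cyl_verts_def)
  then have ne: "p \<noteq> []" using r c by auto
  have inj: "inj_on ?f (cyl_verts r c)"
    by (metis inj_onI reflect_invol)
  have im: "?f ` cyl_verts r c = cyl_verts r c"
    by (metis (no_types, lifting) image_eqI image_subsetI reflect_in reflect_invol subsetI subset_antisym)
  have sp: "set s \<subseteq> cyl_verts r c" using setp p by auto
  have "hamiltonian_path r c (map ?f p)"
  proof (rule hamiltonian_pathI)
    show "set (map ?f p) = cyl_verts r c" using setp im by simp
    show "length (map ?f p) \<le> r * c" by (simp add: lenp)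
    show "successively (cyl_adj r c) (map ?f p)"
      unfolding successively_map using succ by (rule successively_mono) (rule cyl_adj_reflect)
  qed
  moreover have "map ?f s = gg_start1 r k \<or> map ?f s = gg_start2 r k"
    using s
  proof
    assume "s = gg_start1 r k"
    then show ?thesis using reflect_gg_start1[OF k] by simp
  next
    assume s2: "s = gg_start2 r k"
    \<comment> \<open>The second form is itself a reflected first form, so reflecting it again gives
      the first form back.\<close>
    have sub: "set (gg_start1 r k) \<subseteq> cyl_verts r 2"
      by (auto simp: gg_start1_def set_zigzag cyl_verts_def)
    have "?f (?f v) = v" if "v \<in> set (gg_start1 r k)" for v
      using that sub reflect_invol[of v r 2] by blast
    then have "map ?f (map ?f (gg_start1 r k)) = gg_start1 r k"
      by (simp add: map_idI)
    then show ?thesis using reflect_gg_start1[OF k] s2 by simp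
  qed
  moreover have "map ?f p = map ?f s @ concat (map (\<lambda>j. map ?f (seg j)) [1..<c])"
    by (simp add: p map_concat comp_def)
  moreover have "set (map ?f (seg j)) = {0..<r} \<times> {j} - set (map ?f s)" if "j \<in> {1..<c}" for j
  proof -
    have sub: "{0..<r} \<times> {j} \<subseteq> cyl_verts r c" using that by (auto simp: cyl_verts_def)
    have "?f ` ({0..<r} \<times> {j}) \<subseteq> {0..<r} \<times> {j}"
      using r by (auto simp: reflect_def)
    moreover have "{0..<r} \<times> {j} \<subseteq> ?f ` ({0..<r} \<times> {j})"
    proof
      fix v assume v: "v \<in> {0..<r} \<times> {j}"
      then have "?f v \<in> {0..<r} \<times> {j}" using r by (auto simp: reflect_def)
      then show "v \<in> ?f ` ({0..<r} \<times> {j})"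
        using v sub reflect_invol by (metis image_eqI subsetD)
    qed
    ultimately have column: "?f ` ({0..<r} \<times> {j}) = {0..<r} \<times> {j}" by blast
    have "{0..<r} \<times> {j} - set s \<subseteq> cyl_verts r c" using sub by blast
    from inj_on_image_set_diff[OF inj this sp] show ?thesis
      unfolding set_map seg[OF that] column .
  qed
  ultimately have "gg_path r c k (map ?f p)"
    unfolding gg_path_def using k
    by (intro conjI exI[of _ "map ?f s"] exI[of _ "\<lambda>j. map ?f (seg j)"]) auto
  moreover have "num_horizontal (map ?f p) = num_horizontal p"
  proof -
    have "horizontal (?f u) (?f v) \<longleftrightarrow> horizontal u v" if "u \<in> set p" "v \<in> set p" for u v
      using that horizontal_reflect[of u v r] horizontal_reflect[of "?f u" "?f v" r]
        reflect_invol setp by metis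
    then have "Suc i < length p \<Longrightarrow>
        horizontal (?f (p ! i)) (?f (p ! Suc i)) \<longleftrightarrow> horizontal (p ! i) (p ! Suc i)" for i
      by (meson Suc_lessD nth_mem)
    then show ?thesis
      unfolding num_horizontal_def by (intro arg_cong[of _ _ card] Collect_cong) auto
  qed
  moreover have "last (map ?f p) = (nat (- y mod int r), c - 1)"
  proof -
    define a where "a = nat (y mod int r)"
    have a: "a < r" "int a = y mod int r" using r by (auto simp: a_def nat_less_iff)
    have "int ((r - a) mod r) = (int r - y mod int r) mod int r"
      using a by (simp add: zmod_int of_nat_diff)
    also have "\<dots> = - y mod int r"
      by (metis mod_diff_right_eq minus_mod_self1 diff_0 mod_diff_left_eq mod_self)
    finally have "nat (- y mod int r) = (r - a) mod r" by (metis nat_int)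
    then show ?thesis using ne lastp by (simp add: last_map reflect_def a_def)
  qed
  ultimately show ?thesis using nh unfolding gg_reaches_def by auto
qed

section \<open>Every admissible displacement is reached\<close>

lemma gg_reaches_all:
  assumes "c \<ge> 2" "2 * m + 2 \<le> r" "\<bar>y\<bar> \<le> int c + 2 * int m" "even (y + int c)"
  shows "\<exists>k\<le>m. gg_reaches r c k y"
  using assms(1,3,4)
proof (induction c arbitrary: y rule: dec_induct)
  case base
  show ?case
  proof (cases "y = 0")
    case True
    then show ?thesis using gg_reaches_zero[of r] assms(2) by auto
  next
    case False
    have "even y" using base by simp
    then obtain b where b: "y = 2 * b" by (rule evenE)
    \<comment> \<open>Chosen so that \<open>2 * k + 2 = \<bar>y\<bar>\<close>; here \<open>b\<close>
      is nonzero, so \<open>nat\<close> cuts nothing off.\<close>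
    define k where "k = nat (\<bar>b\<bar> - 1)"
    have k: "\<bar>y\<bar> = 2 * int k + 2" "k \<le> m"
      using False base b unfolding k_def by auto
    then have "gg_reaches r 2 k (- \<bar>y\<bar>)"
      using gg_reaches_base[of k r] assms(2) by simp
    then have "gg_reaches r 2 k y"
      using gg_reaches_uminus[of 2 r k "- y"] by (cases "y \<ge> 0") auto
    then show ?thesis using k by blast
  qed
next
  case (step c)
  show ?case
  proof (cases "y \<ge> 0")
    case True
    \<comment> \<open>A new column only lowers the displacement, so for \<open>y \<ge> 0\<close> the
      target is \<open>- y\<close>, reached from \<open>- y + 1\<close> and then reflected.\<close>
    then have "\<bar>- (y - 1)\<bar> \<le> int c + 2 * int m" "even (- (y - 1) + int c)"
      using step by auto
    then obtain k where k: "k \<le> m" "gg_reaches r c k (- (y - 1))"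
      using step.IH by blast
    then have "gg_reaches r (Suc c) k (- y)"
      using gg_reaches_Suc[OF step.hyps(1) k(2)] by simp
    then show ?thesis using gg_reaches_uminus[of "Suc c" r k "- y"] k(1) by auto
  next
    case False
    then have "\<bar>y + 1\<bar> \<le> int c + 2 * int m" "even ((y + 1) + int c)"
      using step by auto
    then obtain k where k: "k \<le> m" "gg_reaches r c k (y + 1)"
      using step.IH by blast
    then show ?thesis using gg_reaches_Suc[OF step.hyps(1) k(2)] by auto
  qed
qed

text \<open>While \<open>\<bar>y\<bar> > r\<close>, a shift by \<open>2 * r\<close> toward
  \<open>0\<close> decreases \<open>\<bar>y\<bar>\<close>. A shift by \<open>r\<close> alone would
  change the parity for odd \<open>r\<close>.\<close>

lemma small_representative:
  fixes y r :: int
  assumes "r > 0"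
  shows "\<exists>z. z mod r = y mod r \<and> even (z + y) \<and> \<bar>z\<bar> \<le> r \<and> \<bar>z\<bar> \<le> \<bar>y\<bar>"
proof (induction "nat \<bar>y\<bar>" arbitrary: y rule: less_induct)
  case less
  show ?case
  proof (cases "\<bar>y\<bar> \<le> r")
    case True
    then show ?thesis by (intro exI[of _ y]) auto
  next
    case False
    define w where "w = (if y > 0 then y - 2 * r else y + 2 * r)"
    have w: "\<bar>w\<bar> < \<bar>y\<bar>" "even (w + y)"
      using False assms by (auto simp: w_def)
    have "w = y + r * (if y > 0 then - 2 else 2)" by (simp add: w_def)
    then have wr: "w mod r = y mod r" by (metis mod_mult_self2)
    obtain z where z: "z mod r = w mod r" "even (z + w)" "\<bar>z\<bar> \<le> r" "\<bar>z\<bar> \<le> \<bar>w\<bar>"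
      using less[of w] w(1) nat_mono_iff[of "\<bar>y\<bar>" "\<bar>w\<bar>"] by fastforce
    have "even (z + y)" using z(2) w(2) by presburger
    then show ?thesis using z w wr by (intro exI[of _ z]) auto
  qed
qed

theorem theorem3:
  fixes r c m :: nat and P :: "(nat \<times> nat) list"
  assumes "r \<ge> 2" and "c \<ge> 2"
    and "hamiltonian_path r c P"
    and "hd P = (0, 0)"
    and "snd (last P) = c - 1"
    and "num_horizontal P \<le> (c - 1) + 2 * m"
  shows "\<exists>x \<in> gg_ends r c m. last P = (x, c - 1)"
proof -
  obtain y :: int where y: "\<bar>y\<bar> \<le> int (num_horizontal P) + 1" "even (y + int (snd (last P)) + 1)"
    "y mod int r = int (fst (last P))"
    using hamiltonian_path_end[of r c P] assms by auto
  obtain z where z: "z mod int r = y mod int r" "even (z + y)" "\<bar>z\<bar> \<le> int r" "\<bar>z\<bar> \<le> \<bar>y\<bar>"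
    using small_representative[of "int r" y] assms(1) by auto
  \<comment> \<open>The budget \<open>m\<close>, capped so that \<open>2 * n + 2 \<le> r\<close> as
    \<open>gg_reaches_all\<close> demands.\<close>
  define n where "n = min m ((r - 2) div 2)"
  have n: "2 * n + 2 \<le> r" "n \<le> m" using assms(1) by (auto simp: n_def)
  have "even (y + int c)" using y(2) assms(2,5) by (simp add: of_nat_diff)
  then have par: "even (z + int c)" using z(2) by presburger
  have "\<bar>z\<bar> \<le> int c + 2 * int m" using z(4) y(1) assms(2,6) by linarith
  \<comment> \<open>The right side is at least \<open>r\<close>, except that it is
    \<open>r - 1\<close> for odd \<open>r\<close> and \<open>c = 2\<close>; there \<open>z\<close>
    is even, so \<open>\<bar>z\<bar>\<close> differs from \<open>r\<close>.\<close>
  moreover have "\<bar>z\<bar> \<le> int c + 2 * int ((r - 2) div 2)"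
    using z(3) par assms(1,2) by presburger
  ultimately have "\<bar>z\<bar> \<le> int c + 2 * int n" by (simp add: n_def min_def)
  then obtain k p where k: "k \<le> n" and p: "gg_path r c k p"
    "num_horizontal p = 2 * k + 1 + (c - 2)" "last p = (nat (z mod int r), c - 1)"
    using gg_reaches_all[OF assms(2) n(1) _ par] by (auto simp: gg_reaches_def)
  have "last p = (fst (last P), c - 1)" using p(3) z(1) y(3) by simp
  moreover have "num_horizontal p \<le> 2 * m + (c - 1)" using p(2) k n(2) assms(2) by simp
  ultimately have "fst (last P) \<in> gg_ends r c m" using p(1) by (auto simp: gg_ends_def)
  then show ?thesis using assms(5) by (metis prod.collapse)
qed

end
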